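(* Let $\mathbb{F}$ be an arbitrary field, $d\ge 1$ an integer, and let $E\subset\mathbb{F}^d$ be a finite set such that no line contains more than $|E|/2$ points of $E$. Then for every positive integer $M < |E|/4$, $$\#\{y \in \mathbb{F}^d: |\pi^y(E)| < M\} < 4M^2.$$
   Context: For a field $\mathbb{F}$ and a point $y\in\mathbb{F}^d$, the radial projection $\pi^y$ maps each point $x\neq y$ of $\mathbb{F}^d$ to the (affine) line containing $x$ and $y$. For $E\subset\mathbb{F}^d$, $\pi^y(E)=\{\pi^y(x): x\in E\setminus\{y\}\}$; thus $|\pi^y(E)|$ is the number of lines through $y$ that contain at least one point of $E\setminus\{y\}$. *)

theory Defs
  imports "HOL-Analysis.Cartesian_Space"
begin

definition affine_line :: "('a::field ^ 'n) set \<Rightarrow> bool" where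
  "affine_line L \<longleftrightarrow> (\<exists>p v. v \<noteq> 0 \<and> L = {p + t *s v | t. True})"

text \<open>The value at \<open>x = y\<close> is junk (a singleton); \<open>\<pi>\<^sup>y(x)\<close> is only meant for \<open>x \<noteq> y\<close>,
  where by the lemma below it is the unique affine line containing \<open>x\<close> and \<open>y\<close>.\<close>

definition radial_proj :: "'a::field ^ 'n \<Rightarrow> 'a ^ 'n \<Rightarrow> ('a ^ 'n) set" where
  "radial_proj y x = {y + t *s (x - y) | t. True}"

definition radial_image :: "'a::field ^ 'n \<Rightarrow> ('a ^ 'n) set \<Rightarrow> ('a ^ 'n) set set" where
  "radial_image y E = radial_proj y ` (E - {y})"

lemma radial_proj_unique_line:
  fixes x y :: "'a::field ^ 'n"
  assumes "x \<noteq> y"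
  shows "affine_line L \<and> x \<in> L \<and> y \<in> L \<longleftrightarrow> L = radial_proj y x"
proof
  assume "affine_line L \<and> x \<in> L \<and> y \<in> L"
  then obtain p v a b where L: "L = {p + t *s v | t. True}"
    and x: "x = p + a *s v" and y: "y = p + b *s v"
    by (auto simp: affine_line_def)
  have ab: "a - b \<noteq> 0" using assms x y by auto
  have d: "x - y = (a - b) *s v" by (simp add: x y vec_eq_iff algebra_simps)
  have "p + t *s v = y + ((t - b) / (a - b)) *s (x - y)" for t
    unfolding d using ab by (simp add: y vec_eq_iff) (simp add: algebra_simps)
  moreover have "y + t *s (x - y) = p + (b + t * (a - b)) *s v" for t
    unfolding d by (simp add: y vec_eq_iff algebra_simps)
  ultimately show "L = radial_proj y x"
    unfolding L radial_proj_def by blast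
next
  assume L: "L = radial_proj y x"
  have "x - y \<noteq> 0" using assms by simp
  moreover have "x = y + 1 *s (x - y)" "y = y + 0 *s (x - y)"
    by (simp_all add: vec_eq_iff)
  ultimately show "affine_line L \<and> x \<in> L \<and> y \<in> L"
    unfolding L affine_line_def radial_proj_def by blast
qed

end

theory Submission
  imports Defs "HOL-Analysis.Convex"
begin

text \<open>
  The proof counts triples. Let \<open>m = M - 1\<close>, and call \<open>y\<close> \<^emph>\<open>poor\<close> if at most \<open>m\<close> lines through \<open>y\<close>
  cover \<open>E - {y}\<close>. By Cauchy--Schwarz, a poor point is collinear with many pairs of distinct points
  of \<open>E\<close>: about \<open>N\<^sup>2/m\<close> ordered pairs, where \<open>N = card E\<close>. On the other hand, the poor points
  collinear with a given pair all lie on the line that the pair spans. So if no line contains more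
  than \<open>k\<close> poor points, there are at most about \<open>k N\<^sup>2\<close> triples, whence about \<open>k m\<close> poor points at
  most (\<open>radial_double_count\<close>).

  The same count bounds \<open>k\<close>. For a line \<open>L\<close>, replace \<open>E\<close> by \<open>E - L\<close>, which by hypothesis still has at
  least \<open>N/2 > 2 M\<close> points. The line spanned by two of them differs from \<open>L\<close>, so it meets \<open>L\<close> in at most
  one point, and each pair now occurs in at most one triple with a poor point on \<open>L\<close>. This gives
  \<open>k \<le> 2 m\<close> (\<open>poor_points_on_line\<close>), and then the count for \<open>E\<close> itself, together with \<open>N > 4 M\<close>, gives
  at most \<open>4 m\<^sup>2 < 4 M\<^sup>2\<close> poor points in any finite set, hence in all.
\<close>

text \<open>Cauchy--Schwarz for the fibre sizes of \<open>f\<close>: they sum to \<open>card A\<close>, and their squares sum to the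
  number of pairs with equal images.\<close>

lemma card_square_le_card_image_times_pairs:
  assumes "finite A"
  shows "(card A)\<^sup>2 \<le> card (f ` A) * card {(a, b). a \<in> A \<and> b \<in> A \<and> f a = f b}"
proof -
  define F where "F = (\<lambda>c. {a \<in> A. f a = c})"
  have finF: "finite (F c)" for c
    using assms by (simp add: F_def)
  have "A = (\<Union>c\<in>f ` A. F c)"
    by (auto simp: F_def)
  then have "card A = card (\<Union>c\<in>f ` A. F c)" by simp
  also have "\<dots> = (\<Sum>c\<in>f ` A. card (F c))"
    by (rule card_UN_disjoint) (use assms finF in \<open>auto simp: F_def\<close>)
  finally have cA: "card A = (\<Sum>c\<in>f ` A. card (F c))" .
  have "{(a, b). a \<in> A \<and> b \<in> A \<and> f a = f b} = (\<Union>c\<in>f ` A. F c \<times> F c)"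
    by (auto simp: F_def)
  then have "card {(a, b). a \<in> A \<and> b \<in> A \<and> f a = f b} = card (\<Union>c\<in>f ` A. F c \<times> F c)" by simp
  also have "\<dots> = (\<Sum>c\<in>f ` A. card (F c \<times> F c))"
    by (rule card_UN_disjoint) (use assms finF in \<open>auto simp: F_def\<close>)
  finally have cP: "card {(a, b). a \<in> A \<and> b \<in> A \<and> f a = f b} = (\<Sum>c\<in>f ` A. (card (F c))\<^sup>2)"
    by (simp add: card_cartesian_product power2_eq_square)
  have "(\<Sum>c\<in>f ` A. real (card (F c)))\<^sup>2 \<le> (\<Sum>c\<in>f ` A. (real (card (F c)))\<^sup>2) * card (f ` A)"
    by (rule sum_squared_le_sum_of_squares)
  then have "real ((card A)\<^sup>2) \<le>
      real (card (f ` A) * card {(a, b). a \<in> A \<and> b \<in> A \<and> f a = f b})"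
    unfolding cA cP by (simp add: mult.commute)
  then show ?thesis
    by (simp only: of_nat_le_iff)
qed

lemma card_pairs_diagonal:
  assumes "finite A"
  shows "card {(a, b). a \<in> A \<and> b \<in> A \<and> f a = f b} =
    card {(a, b). a \<in> A \<and> b \<in> A \<and> a \<noteq> b \<and> f a = f b} + card A"
proof -
  have eq: "{(a, b). a \<in> A \<and> b \<in> A \<and> f a = f b} =
      {(a, b). a \<in> A \<and> b \<in> A \<and> a \<noteq> b \<and> f a = f b} \<union> (\<lambda>a. (a, a)) ` A"
    by auto
  have "finite {(a, b). a \<in> A \<and> b \<in> A \<and> a \<noteq> b \<and> f a = f b}"
    by (rule finite_subset[of _ "A \<times> A"]) (use assms in auto)
  then show ?thesis
    unfolding eq using assms
    by (subst card_Un_disjoint) (auto simp: card_image inj_on_def)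
qed

lemma card_distinct_pairs:
  assumes "finite A"
  shows "real (card {(a, b). a \<in> A \<and> b \<in> A \<and> a \<noteq> b}) = real (card A) * (real (card A) - 1)"
proof -
  have "{(a, b). a \<in> A \<and> b \<in> A} = A \<times> A"
    by auto
  then show ?thesis
    using card_pairs_diagonal[OF assms, of "\<lambda>_. ()"]
    by (simp add: card_cartesian_product algebra_simps flip: of_nat_mult of_nat_add)
qed

text \<open>Double counting of the triples \<open>(y, x, x')\<close> with \<open>x \<noteq> x'\<close> in \<open>S - {y}\<close> that project to the same line
  through \<open>y \<in> T\<close>: Cauchy--Schwarz bounds their number from below for each \<open>y\<close>, and \<open>k\<close> bounds it from
  above for each pair. The number \<open>n\<close> is separate from \<open>card S\<close> because a point of \<open>T\<close> may belong to \<open>S\<close>.\<close>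

lemma radial_double_count:
  fixes S T :: "('a::field ^ 'n) set"
  assumes "finite S" "finite T"
    and lines: "\<And>y. y \<in> T \<Longrightarrow> card (radial_image y S) \<le> m"
    and large: "\<And>y. y \<in> T \<Longrightarrow> n \<le> card (S - {y})" and "m \<le> n"
    and pairs: "\<And>x x'. x \<in> S \<Longrightarrow> x' \<in> S \<Longrightarrow> x \<noteq> x' \<Longrightarrow>
      card {y \<in> T. x \<noteq> y \<and> x' \<noteq> y \<and> radial_proj y x = radial_proj y x'} \<le> k"
  shows "real (card T) * (real n * (real n - real m)) \<le>
    real m * (real k * (real (card S) * (real (card S) - 1)))"
proof -
  define P where "P = {(x, x'). x \<in> S \<and> x' \<in> S \<and> x \<noteq> x'}"
  define R where "R = (\<lambda>(y :: 'a ^ 'n) (x, x'). x \<noteq> y \<and> x' \<noteq> y \<and> radial_proj y x = radial_proj y x')"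
  have finP: "finite P"
    by (rule finite_subset[of _ "S \<times> S"]) (use assms in \<open>auto simp: P_def\<close>)
  have lower: "real n * (real n - real m) \<le> real m * real (card {p \<in> P. R y p})" if "y \<in> T" for y
  proof -
    let ?A = "S - {y}"
    have fin: "finite ?A" using assms by simp
    have eq: "{p \<in> P. R y p} =
        {(x, x'). x \<in> ?A \<and> x' \<in> ?A \<and> x \<noteq> x' \<and> radial_proj y x = radial_proj y x'}"
      by (auto simp: P_def R_def)
    have "(card ?A)\<^sup>2 \<le> card (radial_image y S) * (card {p \<in> P. R y p} + card ?A)"
      using card_square_le_card_image_times_pairs[OF fin, of "radial_proj y"]
      unfolding eq radial_image_def card_pairs_diagonal[OF fin] .
    also have "\<dots> \<le> m * (card {p \<in> P. R y p} + card ?A)"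
      using lines[OF that] by (rule mult_right_mono) simp
    finally have "real ((card ?A)\<^sup>2) \<le> real (m * (card {p \<in> P. R y p} + card ?A))"
      by (simp only: of_nat_le_iff)
    then have "real (card ?A) * (real (card ?A) - real m) \<le> real m * real (card {p \<in> P. R y p})"
      by (simp add: power2_eq_square algebra_simps)
    moreover have "real n * (real n - real m) \<le> real (card ?A) * (real (card ?A) - real m)"
      using large[OF that] \<open>m \<le> n\<close> by (intro mult_mono) auto
    ultimately show ?thesis by linarith
  qed
  have upper: "card {y \<in> T. R y p} \<le> k" if "p \<in> P" for p
    using that pairs by (auto simp: P_def R_def)
  have "real (card T) * (real n * (real n - real m)) = (\<Sum>y\<in>T. real n * (real n - real m))"
    by simp
  also have "\<dots> \<le> (\<Sum>y\<in>T. real m * real (card {p \<in> P. R y p}))"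
    by (rule sum_mono) (rule lower)
  also have "\<dots> = real m * real (\<Sum>y\<in>T. card {p \<in> P. R y p})"
    by (simp add: sum_distrib_left)
  also have "(\<Sum>y\<in>T. card {p \<in> P. R y p}) = (\<Sum>p\<in>P. card {y \<in> T. R y p})"
    using sum.swap_restrict[OF \<open>finite T\<close> finP, of "\<lambda>_ _. 1::nat" R] by simp
  also have "real m * real (\<Sum>p\<in>P. card {y \<in> T. R y p}) \<le> real m * real (\<Sum>p\<in>P. k)"
    by (intro mult_left_mono of_nat_mono sum_mono upper) auto
  also have "\<dots> = real m * (real k * (real (card S) * (real (card S) - 1)))"
    using card_distinct_pairs[OF \<open>finite S\<close>] by (simp add: P_def)
  finally show ?thesis .
qed

lemma affine_lines_meet_once:
  assumes "affine_line L" "affine_line L'" "L \<noteq> L'" "y \<in> L \<inter> L'" "z \<in> L \<inter> L'"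
  shows "y = z"
  using assms radial_proj_unique_line by (metis IntD1 IntD2)

lemma equal_radial_proj_imp_collinear:
  assumes "x \<noteq> x'" "x \<noteq> y" "x' \<noteq> y" "radial_proj y x = radial_proj y x'"
  shows "y \<in> radial_proj x x'"
  using assms radial_proj_unique_line by metis

text \<open>The double count with \<open>S = E - L\<close> and \<open>k = 1\<close>. It bounds \<open>card T\<close> by roughly \<open>m s / (s - m)\<close> with
  \<open>s = card (E - L)\<close>, and \<open>s > 2 m\<close> keeps the denominator above \<open>s / 2\<close>.\<close>

lemma poor_points_on_line:
  fixes E T :: "('a::field ^ 'n) set"
  assumes "finite E" "finite T" "affine_line L" "T \<subseteq> L"
    and lines: "\<And>y. y \<in> T \<Longrightarrow> card (radial_image y E) \<le> m"
    and off: "2 * m < card (E - L)"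
  shows "card T \<le> 2 * m"
proof -
  let ?S = "E - L"
  let ?s = "real (card ?S)"
  have "real (card T) * (?s * (?s - real m)) \<le> real m * (real 1 * (?s * (?s - 1)))"
  proof (rule radial_double_count)
    show "finite ?S" "finite T" "m \<le> card ?S" using assms by auto
    show "card (radial_image y ?S) \<le> m" if "y \<in> T" for y
    proof -
      have "card (radial_image y ?S) \<le> card (radial_image y E)"
        unfolding radial_image_def using \<open>finite E\<close> by (intro card_mono) auto
      then show ?thesis using lines[OF that] by simp
    qed
    show "card ?S \<le> card (?S - {y})" if "y \<in> T" for y
      using that \<open>T \<subseteq> L\<close> by (simp add: subset_iff)
    fix x x' assume x: "x \<in> ?S" "x' \<in> ?S" "x \<noteq> x'"
    have line: "affine_line (radial_proj x x')" "x \<in> radial_proj x x'"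
      using radial_proj_unique_line[of x' x "radial_proj x x'"] x by auto
    then have "radial_proj x x' \<noteq> L"
      using x by blast
    then have "y = z" if "y \<in> L \<inter> radial_proj x x'" "z \<in> L \<inter> radial_proj x x'" for y z
      using affine_lines_meet_once[OF \<open>affine_line L\<close> line(1)] that by blast
    moreover have "{y \<in> T. x \<noteq> y \<and> x' \<noteq> y \<and> radial_proj y x = radial_proj y x'} \<subseteq>
        L \<inter> radial_proj x x'"
      using \<open>T \<subseteq> L\<close> equal_radial_proj_imp_collinear[OF x(3)] by blast
    ultimately show "card {y \<in> T. x \<noteq> y \<and> x' \<noteq> y \<and> radial_proj y x = radial_proj y x'} \<le> 1"
      using \<open>finite T\<close> by (subst card_le_Suc0_iff_eq[unfolded One_nat_def[symmetric]]) auto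
  qed
  then have "?s * (real (card T) * (?s - real m)) \<le> ?s * (real m * (?s - 1))"
    by (simp add: algebra_simps)
  moreover have "0 < ?s"
    using off by simp
  ultimately have "real (card T) * (?s - real m) \<le> real m * (?s - 1)"
    by simp
  also have "\<dots> \<le> real m * ?s"
    by (simp add: algebra_simps)
  finally have "real (card T) * (?s - real m) \<le> real m * ?s" .
  moreover have "real (card T) * (?s / 2) \<le> real (card T) * (?s - real m)"
    using off by (intro mult_left_mono) auto
  ultimately have "?s * real (card T) \<le> ?s * (2 * real m)"
    by (simp add: algebra_simps)
  with \<open>0 < ?s\<close> have "real (card T) \<le> 2 * real m"
    by simp
  then show ?thesis by linarith
qed

theorem theorem1p8:
  fixes E :: "('a::field ^ 'n) set" and M :: nat
  assumes "finite E"
    and "\<And>L. affine_line L \<Longrightarrow> real (card (E \<inter> L)) \<le> real (card E) / 2"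
    and "M > 0"
    and "real M < real (card E) / 4"
  shows "finite {y. card (radial_image y E) < M}
    \<and> card {y. card (radial_image y E) < M} < 4 * M ^ 2"
proof -
  let ?Y = "{y. card (radial_image y E) < M}"
  define m where "m = M - 1"
  define N where "N = card E"
  have M: "M = m + 1" and N: "4 * m + 4 < N"
    using assms(3,4) by (auto simp: m_def N_def)
  have bound: "card T \<le> 4 * m\<^sup>2" if T: "T \<subseteq> ?Y" "finite T" for T
  proof -
    have lines: "card (radial_image y E) \<le> m" if "y \<in> T" for y
      using that T(1) M by auto
    have on_line: "card (T \<inter> L) \<le> 2 * m" if L: "affine_line L" for L
    proof (rule poor_points_on_line[OF \<open>finite E\<close> _ L])
      have "card (E - L) = N - card (E \<inter> L)"
        using \<open>finite E\<close> by (simp add: N_def card_Diff_subset_Int)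
      then show "2 * m < card (E - L)"
        using assms(2)[OF L] N unfolding N_def by linarith
    qed (use T lines in auto)
    \<comment> \<open>A poor point may belong to \<open>E\<close>, which then leaves only \<open>N - 1\<close> points to project.\<close>
    have "real (card T) * (real (N - 1) * (real (N - 1) - real m)) \<le>
        real m * (real (2 * m) * (real (card E) * (real (card E) - 1)))"
    proof (rule radial_double_count[OF \<open>finite E\<close> T(2) lines])
      show "N - 1 \<le> card (E - {y})" for y
        using \<open>finite E\<close> by (simp add: N_def card_Diff_singleton_if)
      show "m \<le> N - 1" using N by simp
      fix x x' assume x: "x \<in> E" "x' \<in> E" "x \<noteq> x'"
      have "{y \<in> T. x \<noteq> y \<and> x' \<noteq> y \<and> radial_proj y x = radial_proj y x'} \<subseteq> T \<inter> radial_proj x x'"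
        using equal_radial_proj_imp_collinear[OF x(3)] by blast
      then have "card {y \<in> T. x \<noteq> y \<and> x' \<noteq> y \<and> radial_proj y x = radial_proj y x'}
          \<le> card (T \<inter> radial_proj x x')"
        using T(2) by (intro card_mono) auto
      also have "\<dots> \<le> 2 * m"
        using on_line radial_proj_unique_line[of x' x "radial_proj x x'"] x by auto
      finally show "card {y \<in> T. x \<noteq> y \<and> x' \<noteq> y \<and> radial_proj y x = radial_proj y x'} \<le> 2 * m" .
    qed
    then have "(real N - 1) * (real (card T) * (real N - 1 - real m)) \<le>
        (real N - 1) * (2 * (real m)\<^sup>2 * real N)"
      using N by (simp add: N_def of_nat_diff power2_eq_square algebra_simps)
    then have "real (card T) * (real N - 1 - real m) \<le> 2 * (real m)\<^sup>2 * real N"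
      using N by simp
    moreover have "real (card T) * (real N / 2) \<le> real (card T) * (real N - 1 - real m)"
      using N by (intro mult_left_mono) auto
    ultimately have "real N * real (card T) \<le> real N * (4 * (real m)\<^sup>2)"
      by (simp add: algebra_simps)
    then have "real (card T) \<le> real (4 * m\<^sup>2)"
      using N by simp
    then show "card T \<le> 4 * m\<^sup>2"
      by (simp only: of_nat_le_iff)
  qed
  have "finite ?Y \<and> card ?Y \<le> 4 * m\<^sup>2"
    by (rule finite_if_finite_subsets_card_bdd) (rule bound)
  moreover have "4 * m\<^sup>2 < 4 * M\<^sup>2"
    unfolding M by (simp add: power2_eq_square)
  ultimately show ?thesis
    by (meson le_less_trans)
qed

end
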